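(* For every $\mathbf k\in\mathbb H^\dagger$ the generalized trigonometric functions $u=\mathsf{CC}_{\mathbf k},\mathsf{SC}_{\mathbf k},\mathsf{CS}_{\mathbf k},\mathsf{SS}_{\mathbf k}$ satisfy the eigenvalue equation of the Laplace operator $$\Delta u=-\lambda_{\mathbf k}u,\qquad \lambda_{\mathbf k}=\frac{2\pi^2}{9}\left[(k_1-k_2)^2+(k_2-k_3)^2+(k_3-k_1)^2\right]$$ (so each is an eigenfunction when not identically zero), and they satisfy the following boundary conditions on the triangle $\triangle$: - $u=\mathsf{CC}_{\mathbf k}$: $\frac{\partial u}{\partial n}=0$ on $B_1\cup B_2\cup B_3$; - $u=\mathsf{SC}_{\mathbf k}$: $\frac{\partial u}{\partial n}=0$ on $B_1\cup B_2$ and $u=0$ on $B_3$; - $u=\mathsf{CS}_{\mathbf k}$: $\frac{\partial u}{\partial n}=0$ on $B_3$ and $u=0$ on $B_1\cup B_2$; - $u=\mathsf{SS}_{\mathbf k}$: $u=0$ on $B_1\cup B_2\cup B_3$.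
   Context: Points $(x_1,x_2)\in\mathbb R^2$ are identified with homogeneous coordinates $\mathbf t=(t_1,t_2,t_3)$, $t_1+t_2+t_3=0$, via $t_1=\frac{\sqrt3}{2}x_1-\frac12x_2$, $t_2=x_2$, $t_3=-\frac{\sqrt3}{2}x_1-\frac12x_2$. $\Delta=\partial_{x_1}^2+\partial_{x_2}^2$ is the Laplace operator; in homogeneous coordinates $\Delta=\frac12[(\partial_{t_1}-\partial_{t_2})^2+(\partial_{t_2}-\partial_{t_3})^2+(\partial_{t_3}-\partial_{t_1})^2]$. Let $\mathbb R^3_H=\{\mathbf t\in\mathbb R^3:t_1+t_2+t_3=0\}$ and $\mathbb H^\dagger=\mathbb Z^3\cap\mathbb R^3_H$. The triangle is $\triangle=\{\mathbf t\in\mathbb R^3_H:0\le t_2\le t_1\le -t_3\le1\}$, with boundary segments $B_1=\{\mathbf t\in\triangle:t_3=-1\}$, $B_2=\{\mathbf t\in\triangle:t_2=0\}$, $B_3=\{\mathbf t\in\triangle:t_1=t_2\}$. $\frac{\partial}{\partial n}$ is the derivative in the direction of the exterior normal of $\triangle$ along the corresponding segment (in the Cartesian plane). Define $\mathbf t\sigma_1=-(t_1,t_3,t_2)$, $\mathbf t\sigma_2=-(t_2,t_1,t_3)$, $\mathbf t\sigma_3=-(t_3,t_2,t_1)$, $\mathcal A_2=\{1,\sigma_1,\sigma_2,\sigma_3,\sigma_1\sigma_2,\sigma_2\sigma_1\}$; $(-1)^{|\sigma|}=1$ for $\sigma\in\{1,\sigma_1\sigma_2,\sigma_2\sigma_1\}$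 and $-1$ for $\sigma\in\{\sigma_1,\sigma_2,\sigma_3\}$. With $\phi_{\mathbf k}(\mathbf t)=e^{\frac{2\pi i}{3}\mathbf k\cdot\mathbf t}$, for $\mathbf k\in\mathbb H^\dagger$: $\mathsf{CC}_{\mathbf k}=\frac1{12}\sum_{\sigma\in\mathcal A_2}(\phi_{\mathbf k\sigma}+\phi_{-\mathbf k\sigma})$, $\mathsf{SC}_{\mathbf k}=\frac1{12i}\sum_{\sigma\in\mathcal A_2}(\phi_{\mathbf k\sigma}-\phi_{-\mathbf k\sigma})$, $\mathsf{CS}_{\mathbf k}=\frac1{12i}\sum_{\sigma\in\mathcal A_2}(-1)^{|\sigma|}(\phi_{\mathbf k\sigma}-\phi_{-\mathbf k\sigma})$, $\mathsf{SS}_{\mathbf k}=-\frac1{12}\sum_{\sigma\in\mathcal A_2}(-1)^{|\sigma|}(\phi_{\mathbf k\sigma}+\phi_{-\mathbf k\sigma})$. *)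

theory Defs
  imports "HOL-Analysis.Analysis"
begin

definition hom_coords :: "real ^ 2 \<Rightarrow> real ^ 3" where
  "hom_coords x = vector [sqrt 3 / 2 * x $ 1 - 1 / 2 * x $ 2, x $ 2, - (sqrt 3 / 2) * x $ 1 - 1 / 2 * x $ 2]"

definition R3H :: "(real ^ 3) set" where
  "R3H = {t. t $ 1 + t $ 2 + t $ 3 = 0}"

definition H_dagger :: "(real ^ 3) set" where
  "H_dagger = {k. \<forall>i. k $ i \<in> \<int>} \<inter> R3H"

lemma bij_betw_hom_coords: "bij_betw hom_coords UNIV R3H"
proof (rule bij_betw_byWitness[where f' = "\<lambda>t. vector [(t $ 1 - t $ 3) / sqrt 3, t $ 2]"])
  show "\<forall>x\<in>UNIV. vector [(hom_coords x $ 1 - hom_coords x $ 3) / sqrt 3, hom_coords x $ 2] = x"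
    by (simp add: hom_coords_def vec_eq_iff forall_2)
  show "\<forall>t\<in>R3H. hom_coords (vector [(t $ 1 - t $ 3) / sqrt 3, t $ 2]) = t"
  proof
    fix t :: "real ^ 3"
    assume "t \<in> R3H"
    then have "t $ 3 = - t $ 1 - t $ 2"
      by (simp add: R3H_def algebra_simps eq_neg_iff_add_eq_0)
    then show "hom_coords (vector [(t $ 1 - t $ 3) / sqrt 3, t $ 2]) = t"
      by (simp add: hom_coords_def vec_eq_iff forall_3 add_divide_distrib diff_divide_distrib algebra_simps)
  qed
qed (auto simp: R3H_def hom_coords_def)


subsection \<open>Differential operators on the Cartesian plane\<close>

definition partial_deriv :: "'n \<Rightarrow> (real ^ 'n \<Rightarrow> 'a) \<Rightarrow> real ^ 'n \<Rightarrow> 'a::real_normed_vector" where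
  "partial_deriv i f x = vector_derivative (\<lambda>s. f (x + s *\<^sub>R axis i 1)) (at 0)"

definition laplacian :: "(real ^ 'n \<Rightarrow> 'a) \<Rightarrow> real ^ 'n \<Rightarrow> 'a::real_normed_vector" where
  "laplacian f x = (\<Sum>i\<in>UNIV. partial_deriv i (partial_deriv i f) x)"

definition twice_differentiable :: "(real ^ 'n \<Rightarrow> 'a::real_normed_vector) \<Rightarrow> bool" where
  "twice_differentiable f \<longleftrightarrow>
     (\<forall>x. f differentiable (at x)) \<and> (\<forall>i x. partial_deriv i f differentiable (at x))"

text \<open>
  Functions of the homogeneous coordinates are regarded as functions of the Cartesian
  coordinates by composition with \<^const>\<open>hom_coords\<close>. Since \<^const>\<open>vector_derivative\<close> is total,
  existence of the derivatives occurring in the equation is made explicit.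
\<close>

definition laplace_eigen_eq :: "(real ^ 3 \<Rightarrow> complex) \<Rightarrow> real \<Rightarrow> bool" where
  "laplace_eigen_eq u \<mu> \<longleftrightarrow>
     twice_differentiable (u \<circ> hom_coords) \<and>
     (\<forall>x. laplacian (u \<circ> hom_coords) x = complex_of_real \<mu> * (u \<circ> hom_coords) x)"

definition laplace_eigenfunction :: "(real ^ 3 \<Rightarrow> complex) \<Rightarrow> real \<Rightarrow> bool" where
  "laplace_eigenfunction u \<mu> \<longleftrightarrow> (\<exists>t\<in>R3H. u t \<noteq> 0) \<and> laplace_eigen_eq u \<mu>"


subsection \<open>The triangle and its boundary segments\<close>

definition ref_triangle :: "(real ^ 3) set" where
  "ref_triangle = {t \<in> R3H. 0 \<le> t $ 2 \<and> t $ 2 \<le> t $ 1 \<and> t $ 1 \<le> - t $ 3 \<and> - t $ 3 \<le> 1}"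

definition B1 :: "(real ^ 3) set" where
  "B1 = {t \<in> ref_triangle. t $ 3 = - 1}"

definition B2 :: "(real ^ 3) set" where
  "B2 = {t \<in> ref_triangle. t $ 2 = 0}"

definition B3 :: "(real ^ 3) set" where
  "B3 = {t \<in> ref_triangle. t $ 1 = t $ 2}"

text \<open>
  The exterior unit normal of a convex planar region \<open>S\<close> along a segment \<open>B\<close> of its boundary.
  At a corner, each of the two adjacent segments contributes its own normal.
\<close>

definition exterior_normal :: "(real ^ 2) set \<Rightarrow> (real ^ 2) set \<Rightarrow> real ^ 2 \<Rightarrow> bool" where
  "exterior_normal S B n \<longleftrightarrow>
     norm n = 1 \<and> (\<forall>p\<in>B. \<forall>q\<in>B. n \<bullet> (q - p) = 0) \<and> (\<forall>p\<in>B. \<forall>q\<in>S. n \<bullet> (q - p) \<le> 0)"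

definition cartesian :: "(real ^ 3) set \<Rightarrow> (real ^ 2) set" where
  "cartesian S = hom_coords -` S"

text \<open>
  \<open>\<partial>u/\<partial>n = 0\<close> along \<open>B\<close>, including existence of the derivative.  The universal quantifier over
  \<open>n\<close> ranges over exactly one vector for each of the three segments, see the lemmas
  \<open>exterior_normal_B1\<close>, \<open>exterior_normal_B2\<close> and \<open>exterior_normal_B3\<close> below.
\<close>

definition normal_deriv_zero_on :: "(real ^ 3 \<Rightarrow> complex) \<Rightarrow> (real ^ 3) set \<Rightarrow> bool" where
  "normal_deriv_zero_on u B \<longleftrightarrow>
     (\<forall>n. exterior_normal (cartesian ref_triangle) (cartesian B) n \<longrightarrow>
       (\<forall>x\<in>cartesian B. ((\<lambda>s. (u \<circ> hom_coords) (x + s *\<^sub>R n)) has_vector_derivative 0) (at 0)))"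

definition zero_on :: "(real ^ 3 \<Rightarrow> complex) \<Rightarrow> (real ^ 3) set \<Rightarrow> bool" where
  "zero_on u B \<longleftrightarrow> (\<forall>t\<in>B. u t = 0)"

lemma cartesian_triangle_iff:
  "x \<in> cartesian ref_triangle \<longleftrightarrow>
     0 \<le> x $ 2 \<and> 3 * x $ 2 \<le> sqrt 3 * x $ 1 \<and> sqrt 3 * x $ 1 + x $ 2 \<le> 2"
  by (auto simp: cartesian_def ref_triangle_def R3H_def hom_coords_def)

lemma cartesian_B1_iff:
  "x \<in> cartesian B1 \<longleftrightarrow> x \<in> cartesian ref_triangle \<and> sqrt 3 * x $ 1 + x $ 2 = 2"
  by (auto simp: cartesian_def B1_def hom_coords_def)

lemma cartesian_B2_iff:
  "x \<in> cartesian B2 \<longleftrightarrow> x \<in> cartesian ref_triangle \<and> x $ 2 = 0"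
  by (auto simp: cartesian_def B2_def hom_coords_def)

lemma cartesian_B3_iff:
  "x \<in> cartesian B3 \<longleftrightarrow> x \<in> cartesian ref_triangle \<and> sqrt 3 * x $ 1 = 3 * x $ 2"
  by (auto simp: cartesian_def B3_def hom_coords_def)

lemmas cartesian_iffs = cartesian_triangle_iff cartesian_B1_iff cartesian_B2_iff cartesian_B3_iff

lemma vertices:
  defines "P \<equiv> vector [2 / sqrt 3, 0] :: real ^ 2" and "Q \<equiv> vector [sqrt 3 / 2, 1 / 2] :: real ^ 2"
  shows "0 \<in> cartesian B2" "0 \<in> cartesian B3" "P \<in> cartesian B1" "P \<in> cartesian B2"
    "Q \<in> cartesian B1" "Q \<in> cartesian B3"
    "0 \<in> cartesian ref_triangle" "P \<in> cartesian ref_triangle" "Q \<in> cartesian ref_triangle"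
  by (simp_all add: P_def Q_def cartesian_iffs)

lemma norm_real2_eq_1: "norm (n :: real ^ 2) = 1 \<longleftrightarrow> (n $ 1)\<^sup>2 + (n $ 2)\<^sup>2 = 1"
  by (simp add: norm_eq_1 inner_vec_def sum_2 power2_eq_square)

lemma inner_real2: "(m :: real ^ 2) \<bullet> n = m $ 1 * n $ 1 + m $ 2 * n $ 2"
  by (simp add: inner_vec_def sum_2)

lemma exterior_normal_B1:
  "exterior_normal (cartesian ref_triangle) (cartesian B1) n \<longleftrightarrow> n = vector [sqrt 3 / 2, 1 / 2]"
proof
  assume ext: "exterior_normal (cartesian ref_triangle) (cartesian B1) n"
  have "n \<bullet> (vector [2 / sqrt 3, 0] - vector [sqrt 3 / 2, 1 / 2]) = 0"
    using ext vertices unfolding exterior_normal_def by blast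
  then have 1: "n $ 1 = sqrt 3 * n $ 2"
    by (simp add: inner_real2 field_simps)
  have "(n $ 1)\<^sup>2 + (n $ 2)\<^sup>2 = 1"
    using ext by (simp add: exterior_normal_def norm_real2_eq_1)
  then have "(n $ 2)\<^sup>2 = (1 / 2)\<^sup>2"
    unfolding 1 by (simp add: power_mult_distrib power_divide)
  then have 2: "n $ 2 = 1 / 2 \<or> n $ 2 = - 1 / 2"
    by (simp only: power2_eq_iff) auto
  have "n \<bullet> (0 - vector [2 / sqrt 3, 0]) \<le> 0"
    using ext vertices unfolding exterior_normal_def by blast
  then have "n $ 2 \<ge> 0"
    by (simp add: inner_real2 1)
  with 1 2 show "n = vector [sqrt 3 / 2, 1 / 2]"
    by (auto simp: vec_eq_iff forall_2)
next
  assume "n = vector [sqrt 3 / 2, 1 / 2]"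
  then show "exterior_normal (cartesian ref_triangle) (cartesian B1) n"
    by (simp add: exterior_normal_def norm_real2_eq_1 inner_real2 cartesian_iffs
        power_divide field_simps)
qed

lemma exterior_normal_B2:
  "exterior_normal (cartesian ref_triangle) (cartesian B2) n \<longleftrightarrow> n = vector [0, - 1]"
proof
  assume ext: "exterior_normal (cartesian ref_triangle) (cartesian B2) n"
  have "n \<bullet> (vector [2 / sqrt 3, 0] - 0) = 0"
    using ext vertices unfolding exterior_normal_def by blast
  then have 1: "n $ 1 = 0"
    by (simp add: inner_real2)
  have "(n $ 1)\<^sup>2 + (n $ 2)\<^sup>2 = 1"
    using ext by (simp add: exterior_normal_def norm_real2_eq_1)
  then have 2: "n $ 2 = 1 \<or> n $ 2 = - 1"
    unfolding 1 by (simp add: power2_eq_1_iff)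
  have "n \<bullet> (vector [sqrt 3 / 2, 1 / 2] - 0) \<le> 0"
    using ext vertices unfolding exterior_normal_def by blast
  then have "n $ 2 \<le> 0"
    by (simp add: inner_real2 1)
  with 1 2 show "n = vector [0, - 1]"
    by (auto simp: vec_eq_iff forall_2)
next
  assume "n = vector [0, - 1]"
  then show "exterior_normal (cartesian ref_triangle) (cartesian B2) n"
    by (simp add: exterior_normal_def norm_real2_eq_1 inner_real2 cartesian_iffs)
qed

lemma exterior_normal_B3:
  "exterior_normal (cartesian ref_triangle) (cartesian B3) n \<longleftrightarrow> n = vector [- 1 / 2, sqrt 3 / 2]"
proof
  assume ext: "exterior_normal (cartesian ref_triangle) (cartesian B3) n"
  have "n \<bullet> (vector [sqrt 3 / 2, 1 / 2] - 0) = 0"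
    using ext vertices unfolding exterior_normal_def by blast
  then have 1: "n $ 2 = - sqrt 3 * n $ 1"
    by (simp add: inner_real2 field_simps)
  have "(n $ 1)\<^sup>2 + (n $ 2)\<^sup>2 = 1"
    using ext by (simp add: exterior_normal_def norm_real2_eq_1)
  then have "(n $ 1)\<^sup>2 = (1 / 2)\<^sup>2"
    unfolding 1 by (simp add: power_mult_distrib power_divide)
  then have 2: "n $ 1 = 1 / 2 \<or> n $ 1 = - 1 / 2"
    by (simp only: power2_eq_iff) auto
  have "n \<bullet> (vector [2 / sqrt 3, 0] - 0) \<le> 0"
    using ext vertices unfolding exterior_normal_def by blast
  then have "n $ 1 \<le> 0"
    by (simp add: inner_real2 divide_le_0_iff)
  with 1 2 show "n = vector [- 1 / 2, sqrt 3 / 2]"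
    by (auto simp: vec_eq_iff forall_2)
next
  assume "n = vector [- 1 / 2, sqrt 3 / 2]"
  moreover have "sqrt 3 * x $ 2 \<le> x $ 1" if "x \<in> cartesian ref_triangle" for x
  proof -
    have "sqrt 3 * (sqrt 3 * x $ 2) \<le> sqrt 3 * x $ 1"
      using that by (simp add: cartesian_triangle_iff flip: mult.assoc)
    then show ?thesis
      by simp
  qed
  moreover have "x $ 1 = sqrt 3 * x $ 2" if "x \<in> cartesian B3" for x
  proof -
    have "sqrt 3 * x $ 1 = sqrt 3 * (sqrt 3 * x $ 2)"
      using that by (simp add: cartesian_B3_iff flip: mult.assoc)
    then show ?thesis
      by simp
  qed
  ultimately show "exterior_normal (cartesian ref_triangle) (cartesian B3) n"
    by (auto simp: exterior_normal_def norm_real2_eq_1 inner_real2 power_divide algebra_simps)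
qed


subsection \<open>Generalized trigonometric functions\<close>

definition \<sigma>1 :: "real ^ 3 \<Rightarrow> real ^ 3" where
  "\<sigma>1 t = - vector [t $ 1, t $ 3, t $ 2]"

definition \<sigma>2 :: "real ^ 3 \<Rightarrow> real ^ 3" where
  "\<sigma>2 t = - vector [t $ 2, t $ 1, t $ 3]"

definition \<sigma>3 :: "real ^ 3 \<Rightarrow> real ^ 3" where
  "\<sigma>3 t = - vector [t $ 3, t $ 2, t $ 1]"

text \<open>
  The group acts from the right, so the product \<open>\<sigma>1\<sigma>2\<close> is the map \<open>\<sigma>2 \<circ> \<sigma>1\<close>.
\<close>

definition A2_even :: "(real ^ 3 \<Rightarrow> real ^ 3) set" where
  "A2_even = {id, \<sigma>2 \<circ> \<sigma>1, \<sigma>1 \<circ> \<sigma>2}"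

definition A2 :: "(real ^ 3 \<Rightarrow> real ^ 3) set" where
  "A2 = {id, \<sigma>1, \<sigma>2, \<sigma>3, \<sigma>2 \<circ> \<sigma>1, \<sigma>1 \<circ> \<sigma>2}"

definition sign_A2 :: "(real ^ 3 \<Rightarrow> real ^ 3) \<Rightarrow> complex" where
  "sign_A2 \<sigma> = (if \<sigma> \<in> A2_even then 1 else - 1)"

lemma distinct_A2: "distinct [id, \<sigma>1, \<sigma>2, \<sigma>3, \<sigma>2 \<circ> \<sigma>1, \<sigma>1 \<circ> \<sigma>2]"
proof -
  let ?ev = "\<lambda>f :: real ^ 3 \<Rightarrow> real ^ 3. let t = f (vector [1, 2, 4]) in (t $ 1, t $ 2, t $ 3)"
  have "distinct (map ?ev [id, \<sigma>1, \<sigma>2, \<sigma>3, \<sigma>2 \<circ> \<sigma>1, \<sigma>1 \<circ> \<sigma>2])"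
    by (simp add: \<sigma>1_def \<sigma>2_def \<sigma>3_def)
  then show ?thesis
    by (simp only: distinct_map)
qed

definition \<phi> :: "real ^ 3 \<Rightarrow> real ^ 3 \<Rightarrow> complex" where
  "\<phi> k t = exp (2 * of_real pi * \<i> / 3 * of_real (k \<bullet> t))"

definition CC :: "real ^ 3 \<Rightarrow> real ^ 3 \<Rightarrow> complex" where
  "CC k t = 1 / 12 * (\<Sum>\<sigma>\<in>A2. \<phi> (\<sigma> k) t + \<phi> (- \<sigma> k) t)"

definition SC :: "real ^ 3 \<Rightarrow> real ^ 3 \<Rightarrow> complex" where
  "SC k t = 1 / (12 * \<i>) * (\<Sum>\<sigma>\<in>A2. \<phi> (\<sigma> k) t - \<phi> (- \<sigma> k) t)"

definition CS :: "real ^ 3 \<Rightarrow> real ^ 3 \<Rightarrow> complex" where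
  "CS k t = 1 / (12 * \<i>) * (\<Sum>\<sigma>\<in>A2. sign_A2 \<sigma> * (\<phi> (\<sigma> k) t - \<phi> (- \<sigma> k) t))"

definition SS :: "real ^ 3 \<Rightarrow> real ^ 3 \<Rightarrow> complex" where
  "SS k t = - (1 / 12) * (\<Sum>\<sigma>\<in>A2. sign_A2 \<sigma> * (\<phi> (\<sigma> k) t + \<phi> (- \<sigma> k) t))"

definition eigval :: "real ^ 3 \<Rightarrow> real" where
  "eigval k = 2 * pi\<^sup>2 / 9 * ((k $ 1 - k $ 2)\<^sup>2 + (k $ 2 - k $ 3)\<^sup>2 + (k $ 3 - k $ 1)\<^sup>2)"

end

theory Submission
  imports Defs
begin

text \<open>
  Each of the four functions is a combination of plane waves \<open>\<phi>\<^bsub>m\<^esub>\<close> with \<open>m\<close> in the orbit of \<open>\<plusminus>k\<close>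
  under the reflection group; all these frequencies have the same length, hence the same
  eigenvalue.  The reflections in the lines carrying \<open>B2\<close>, \<open>B3\<close> and \<open>B1\<close> are \<open>\<sigma>3\<close>, \<open>-\<sigma>2\<close> and \<open>\<sigma>2\<close>
  followed by the translation by \<open>(1, 1, -2)\<close>, which is a period of the integral plane waves.
  Under each reflection each function is even, giving a zero normal derivative, or odd, giving
  zero boundary values.
\<close>

subsection \<open>Plane waves and the Laplace operator\<close>

text \<open>Chain rule from the Frechet derivative; it yields both the partial derivatives and,
  below, the normal derivatives.\<close>

lemma has_vector_derivative_along_line:
  assumes "(f has_derivative f') (at x)"
  shows "((\<lambda>s. f (x + s *\<^sub>R v)) has_vector_derivative f' v) (at 0)"
proof -
  have "((\<lambda>s. x + s *\<^sub>R v) has_derivative (\<lambda>s. s *\<^sub>R v)) (at 0)"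
    by (auto intro!: derivative_eq_intros)
  moreover have "(f has_derivative f') (at (x + 0 *\<^sub>R v))"
    using assms by simp
  ultimately have "((\<lambda>s. f (x + s *\<^sub>R v)) has_derivative (\<lambda>s. f' (s *\<^sub>R v))) (at 0)"
    by (rule has_derivative_compose)
  then show ?thesis
    by (simp add: has_vector_derivative_def linear_scale[OF has_derivative_linear[OF assms]])
qed

lemma partial_deriv_eq:
  assumes "(f has_derivative f') (at x)"
  shows "partial_deriv i f x = f' (axis i 1)"
  unfolding partial_deriv_def
  using has_vector_derivative_along_line[OF assms] by (rule vector_derivative_at)

lemma partial_deriv_add:
  assumes "f differentiable (at x)" and "g differentiable (at x)"
  shows "partial_deriv i (\<lambda>x. f x + g x) x = partial_deriv i f x + partial_deriv i g x"
proof -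
  obtain f' g' where f': "(f has_derivative f') (at x)" and g': "(g has_derivative g') (at x)"
    using assms by (auto simp: differentiable_def)
  show ?thesis
    by (simp add: partial_deriv_eq[OF f'] partial_deriv_eq[OF g']
        partial_deriv_eq[OF has_derivative_add[OF f' g']])
qed

lemma partial_deriv_cmult:
  fixes f :: "real ^ 'n \<Rightarrow> complex"
  assumes "f differentiable (at x)"
  shows "partial_deriv i (\<lambda>x. c * f x) x = c * partial_deriv i f x"
proof -
  obtain f' where f': "(f has_derivative f') (at x)"
    using assms by (auto simp: differentiable_def)
  show ?thesis
    by (simp add: partial_deriv_eq[OF f'] partial_deriv_eq[OF has_derivative_mult_right[OF f']])
qed

section \<open>Superposition of solutions\<close>

lemma laplace_eigen_eq_zero: "laplace_eigen_eq (\<lambda>t. 0) \<mu>"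
proof -
  have "partial_deriv i (\<lambda>x::real ^ 2. 0::complex) = (\<lambda>x. 0)" for i
    by (rule ext) (simp add: partial_deriv_eq[OF has_derivative_const])
  then show ?thesis
    by (simp add: laplace_eigen_eq_def twice_differentiable_def laplacian_def comp_def)
qed

lemma laplace_eigen_eq_add:
  assumes u: "laplace_eigen_eq u \<mu>" and v: "laplace_eigen_eq v \<mu>"
  shows "laplace_eigen_eq (\<lambda>t. u t + v t) \<mu>"
proof -
  \<comment> \<open>The identity is one of functions, since it is differentiated a second time.
    Differentiability matters: the total \<open>vector_derivative\<close> is additive only where
    both derivatives exist.\<close>
  have "partial_deriv i (\<lambda>x. u (hom_coords x) + v (hom_coords x)) =
      (\<lambda>x. partial_deriv i (u \<circ> hom_coords) x + partial_deriv i (v \<circ> hom_coords) x)" for i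
    using u v by (auto simp: laplace_eigen_eq_def twice_differentiable_def comp_def partial_deriv_add)
  then show ?thesis
    using u v unfolding laplace_eigen_eq_def twice_differentiable_def laplacian_def
    by (simp add: comp_def partial_deriv_add sum.distrib distrib_left)
qed

lemma laplace_eigen_eq_cmult:
  assumes u: "laplace_eigen_eq u \<mu>"
  shows "laplace_eigen_eq (\<lambda>t. c * u t) \<mu>"
proof -
  have "partial_deriv i (\<lambda>x. c * u (hom_coords x)) =
      (\<lambda>x. c * partial_deriv i (u \<circ> hom_coords) x)" for i
    using u by (auto simp: laplace_eigen_eq_def twice_differentiable_def comp_def partial_deriv_cmult)
  then show ?thesis
    using u unfolding laplace_eigen_eq_def twice_differentiable_def laplacian_def
    by (simp add: comp_def partial_deriv_cmult mult.left_commute flip: sum_distrib_left)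
qed

lemma laplace_eigen_eq_sum:
  assumes "\<And>a. a \<in> A \<Longrightarrow> laplace_eigen_eq (u a) \<mu>"
  shows "laplace_eigen_eq (\<lambda>t. \<Sum>a\<in>A. u a t) \<mu>"
  using assms
  by (induction A rule: infinite_finite_induct) (auto simp: laplace_eigen_eq_zero laplace_eigen_eq_add)

section \<open>Plane waves as eigenfunctions\<close>

lemma has_derivative_plane_wave:
  "((\<lambda>x. exp (\<i> * of_real (w \<bullet> x))) has_derivative
     (\<lambda>h. \<i> * of_real (w \<bullet> h) * exp (\<i> * of_real (w \<bullet> x)))) (at x)"
proof -
  have "((\<lambda>x. \<i> * of_real (w \<bullet> x)) has_derivative (\<lambda>h. \<i> * of_real (w \<bullet> h))) (at x)"
    by (intro has_derivative_mult_right has_derivative_of_real has_derivative_inner_right has_derivative_ident)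
  moreover have "(exp has_derivative (\<lambda>h. h * exp (\<i> * of_real (w \<bullet> x)))) (at (\<i> * complex_of_real (w \<bullet> x)))"
    using DERIV_exp by (auto simp: has_field_derivative_def mult.commute[of _ "exp _"])
  ultimately show ?thesis
    by (rule has_derivative_compose)
qed

lemma partial_deriv_plane_wave:
  "partial_deriv i (\<lambda>x. exp (\<i> * of_real (w \<bullet> x))) =
     (\<lambda>x. \<i> * of_real (w $ i) * exp (\<i> * of_real (w \<bullet> x)))"
  by (rule ext) (simp add: partial_deriv_eq[OF has_derivative_plane_wave] inner_axis)

lemma differentiable_plane_wave:
  "(\<lambda>x. exp (\<i> * of_real (w \<bullet> x))) differentiable (at x)"
  using has_derivative_plane_wave by (rule differentiableI)

lemma twice_differentiable_plane_wave: "twice_differentiable (\<lambda>x. exp (\<i> * of_real (w \<bullet> x)))"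
  by (simp add: twice_differentiable_def partial_deriv_plane_wave differentiable_plane_wave)

text \<open>Each partial derivative multiplies the wave by \<open>\<i> * w $ i\<close>, so the
  second ones contribute \<open>- (w $ i)^2\<close>.\<close>

lemma laplacian_plane_wave:
  "laplacian (\<lambda>x. exp (\<i> * of_real (w \<bullet> x))) x = of_real (- (w \<bullet> w)) * exp (\<i> * of_real (w \<bullet> x))"
proof -
  have "w \<bullet> w = (\<Sum>i\<in>UNIV. w $ i * w $ i)"
    by (simp add: inner_vec_def)
  moreover have "\<i> * (a * (\<i> * b)) = - (a * b)" for a b
    by (subst mult.left_commute) (simp flip: mult.assoc)
  ultimately show ?thesis
    by (simp add: laplacian_def partial_deriv_plane_wave partial_deriv_cmult differentiable_plane_wave
        sum_distrib_right sum_negf mult.assoc)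
qed

lemma laplace_eigen_eq_\<phi>:
  assumes "m \<in> R3H"
  shows "laplace_eigen_eq (\<phi> m) (- eigval m)"
proof -
  \<comment> \<open>Collecting the coefficients of \<open>x $ 1\<close> and \<open>x $ 2\<close> in
    \<open>2 * pi / 3 * (m \<bullet> hom_coords x)\<close> gives this Cartesian frequency; the
    second entry uses that the coordinates of \<open>m\<close> sum to zero.\<close>
  define w :: "real ^ 2" where "w = vector [pi * sqrt 3 / 3 * (m $ 1 - m $ 3), pi * m $ 2]"
  have m3: "m $ 3 = - m $ 1 - m $ 2"
    using assms by (simp add: R3H_def)
  have "w \<bullet> x = 2 * pi / 3 * (m \<bullet> hom_coords x)" for x
    by (simp add: w_def hom_coords_def inner_vec_def sum_2 sum_3 m3 field_simps)
  then have "of_real (w \<bullet> x) = 2 * of_real pi / 3 * complex_of_real (m \<bullet> hom_coords x)" for x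
    by (simp only: of_real_mult of_real_divide of_real_numeral)
  then have *: "\<phi> m \<circ> hom_coords = (\<lambda>x. exp (\<i> * of_real (w \<bullet> x)))"
    by (simp only: \<phi>_def comp_def) (simp add: mult_ac)
  have "w \<bullet> w = (pi * sqrt 3 / 3 * (m $ 1 - m $ 3))\<^sup>2 + (pi * m $ 2)\<^sup>2"
    by (simp add: w_def inner_vec_def sum_2 power2_eq_square)
  also have "\<dots> = pi\<^sup>2 / 3 * (m $ 1 - m $ 3)\<^sup>2 + pi\<^sup>2 * (m $ 2)\<^sup>2"
    by (simp add: power_mult_distrib power_divide)
  also have "\<dots> = eigval m"
    by (simp add: eigval_def m3 power2_eq_square field_simps)
  finally have "w \<bullet> w = eigval m" .
  then show ?thesis
    unfolding laplace_eigen_eq_def *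
    using twice_differentiable_plane_wave[of w] laplacian_plane_wave[of w] by simp
qed

subsection \<open>The reflection group\<close>

lemma \<phi>_uminus: "\<phi> m (- t) = \<phi> (- m) t"
  by (simp add: \<phi>_def)

text \<open>Both maps are negated transpositions, hence symmetric for the inner product, so they
  pass from the point to the frequency.\<close>

lemma \<phi>_\<sigma>: "\<phi> m (\<sigma>2 t) = \<phi> (\<sigma>2 m) t" "\<phi> m (\<sigma>3 t) = \<phi> (\<sigma>3 m) t"
  by (simp_all add: \<phi>_def \<sigma>2_def \<sigma>3_def inner_vec_def sum_3 algebra_simps)

lemma \<sigma>_uminus: "\<sigma>2 (- t) = - \<sigma>2 t" "\<sigma>3 (- t) = - \<sigma>3 t"
  by (simp_all add: \<sigma>2_def \<sigma>3_def vec_eq_iff forall_3)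

text \<open>The inner product of \<open>m\<close> with the shift is \<open>- 3 * m $ 3\<close>; the
  3 cancels the denominator in \<open>\<phi>\<close>, and integrality of \<open>m $ 3\<close> leaves
  a multiple of \<open>2 * pi * \<i>\<close>.\<close>

lemma \<phi>_period:
  assumes "m \<in> H_dagger"
  shows "\<phi> m (t + vector [1, 1, - 2]) = \<phi> m t"
proof -
  have "m \<in> R3H" and "m $ 3 \<in> \<int>"
    using assms by (auto simp: H_dagger_def)
  then obtain j where j: "m $ 3 = of_int j"
    by (auto elim: Ints_cases)
  have "m \<bullet> vector [1, 1, - 2] = - 3 * m $ 3"
    using \<open>m \<in> R3H\<close> by (simp add: R3H_def inner_vec_def sum_3)
  with j have "\<phi> m (t + vector [1, 1, - 2]) =
      exp (2 * of_real pi * \<i> / 3 * of_real (m \<bullet> t) + 2 * of_real pi * \<i> * of_int (- j))"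
    by (simp add: \<phi>_def inner_add_right field_simps)
  also have "\<dots> = \<phi> m t"
    using exp_integer_2pi[of "of_int (- j)"] by (simp add: exp_diff exp_minus \<phi>_def mult_ac)
  finally show ?thesis .
qed

lemma R3H_A2: "\<sigma> k \<in> R3H" if "\<sigma> \<in> A2" "k \<in> R3H"
  using that by (auto simp: A2_def R3H_def \<sigma>1_def \<sigma>2_def \<sigma>3_def)

lemma R3H_uminus: "- k \<in> R3H" if "k \<in> R3H"
  using that by (auto simp: R3H_def)

lemma H_dagger_A2: "\<sigma> k \<in> H_dagger" if "\<sigma> \<in> A2" "k \<in> H_dagger"
proof -
  have "\<forall>i. \<sigma> k $ i \<in> \<int>"
    using that by (auto simp: A2_def H_dagger_def \<sigma>1_def \<sigma>2_def \<sigma>3_def forall_3)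
  then show ?thesis
    using that R3H_A2 by (auto simp: H_dagger_def)
qed

lemma H_dagger_uminus: "- k \<in> H_dagger" if "k \<in> H_dagger"
  using that by (auto simp: H_dagger_def R3H_uminus)

text \<open>The group permutes coordinates up to a common sign, which only permutes the squared
  differences.\<close>

lemma eigval_A2: "eigval (\<sigma> k) = eigval k" if "\<sigma> \<in> A2"
  using that by (auto simp: A2_def eigval_def \<sigma>1_def \<sigma>2_def \<sigma>3_def power2_eq_square algebra_simps)

lemma eigval_uminus: "eigval (- k) = eigval k"
  by (simp add: eigval_def power2_eq_square algebra_simps)

text \<open>Multiplication table for left composition with \<open>\<sigma>2\<close> and
  \<open>\<sigma>3\<close>, limited to products not literally listed in \<open>A2\<close>.\<close>

lemma \<sigma>_comp:
  "\<sigma>2 \<circ> \<sigma>2 = id" "\<sigma>2 \<circ> \<sigma>3 = \<sigma>1 \<circ> \<sigma>2" "\<sigma>2 \<circ> (\<sigma>2 \<circ> \<sigma>1) = \<sigma>1" "\<sigma>2 \<circ> (\<sigma>1 \<circ> \<sigma>2) = \<sigma>3"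
  "\<sigma>3 \<circ> \<sigma>1 = \<sigma>1 \<circ> \<sigma>2" "\<sigma>3 \<circ> \<sigma>2 = \<sigma>2 \<circ> \<sigma>1" "\<sigma>3 \<circ> \<sigma>3 = id"
  "\<sigma>3 \<circ> (\<sigma>2 \<circ> \<sigma>1) = \<sigma>2" "\<sigma>3 \<circ> (\<sigma>1 \<circ> \<sigma>2) = \<sigma>1"
  by (simp_all add: fun_eq_iff \<sigma>1_def \<sigma>2_def \<sigma>3_def vec_eq_iff forall_3)

lemma sign_A2_simps:
  "sign_A2 id = 1" "sign_A2 \<sigma>1 = - 1" "sign_A2 \<sigma>2 = - 1" "sign_A2 \<sigma>3 = - 1"
  "sign_A2 (\<sigma>2 \<circ> \<sigma>1) = 1" "sign_A2 (\<sigma>1 \<circ> \<sigma>2) = 1"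
  \<comment> \<open>The sign is decided by membership in \<open>A2_even\<close>, so the value -1
    requires the reflections to differ from the three even maps.\<close>
  using distinct_A2 by (auto simp: sign_A2_def A2_even_def)

lemma sign_A2_reflection:
  assumes "s \<in> {\<sigma>2, \<sigma>3}" and "\<sigma> \<in> A2"
  shows "sign_A2 (s \<circ> \<sigma>) = - sign_A2 \<sigma>"
  using assms by (auto simp: A2_def sign_A2_simps \<sigma>_comp)

lemma bij_betw_reflection:
  assumes "s \<in> {\<sigma>2, \<sigma>3}"
  shows "bij_betw ((\<circ>) s) A2 A2"
proof (rule bij_betw_byWitness[where f' = "(\<circ>) s"])
  have "s \<circ> s = id"
    using assms \<sigma>_comp by auto
  then show "\<forall>\<sigma>\<in>A2. s \<circ> (s \<circ> \<sigma>) = \<sigma>" "\<forall>\<sigma>\<in>A2. s \<circ> (s \<circ> \<sigma>) = \<sigma>"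
    by (simp_all flip: comp_assoc)
  show "(\<circ>) s ` A2 \<subseteq> A2" "(\<circ>) s ` A2 \<subseteq> A2"
    using assms by (auto simp: A2_def \<sigma>_comp)
qed

subsection \<open>Orbit sums\<close>

text \<open>Common form of the four functions: \<open>c\<close> is a multiple of the trivial or the
  sign character, and \<open>\<epsilon>\<close> (1 or -1) is the parity under
  \<open>t \<mapsto> - t\<close>.\<close>

definition orbit_sum :: "((real ^ 3 \<Rightarrow> real ^ 3) \<Rightarrow> complex) \<Rightarrow> complex \<Rightarrow> real ^ 3 \<Rightarrow> real ^ 3 \<Rightarrow> complex"
  where "orbit_sum c \<epsilon> k t = (\<Sum>\<sigma>\<in>A2. c \<sigma> * (\<phi> (\<sigma> k) t + \<epsilon> * \<phi> (- \<sigma> k) t))"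

lemma trig_eq_orbit_sum:
  "CC k = orbit_sum (\<lambda>\<sigma>. 1 / 12) 1 k"
  "SC k = orbit_sum (\<lambda>\<sigma>. 1 / (12 * \<i>)) (- 1) k"
  "CS k = orbit_sum (\<lambda>\<sigma>. 1 / (12 * \<i>) * sign_A2 \<sigma>) (- 1) k"
  "SS k = orbit_sum (\<lambda>\<sigma>. - (1 / 12) * sign_A2 \<sigma>) 1 k"
  by (simp_all add: fun_eq_iff CC_def SC_def CS_def SS_def orbit_sum_def sum_distrib_left mult.assoc
      del: mult_minus_left)

lemma laplace_eigen_eq_orbit_sum:
  assumes "k \<in> R3H"
  shows "laplace_eigen_eq (orbit_sum c \<epsilon> k) (- eigval k)"
proof -
  have "laplace_eigen_eq (\<phi> (\<sigma> k)) (- eigval k)" "laplace_eigen_eq (\<phi> (- \<sigma> k)) (- eigval k)"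
    if "\<sigma> \<in> A2" for \<sigma>
    using that assms laplace_eigen_eq_\<phi>[of "\<sigma> k"] laplace_eigen_eq_\<phi>[of "- \<sigma> k"]
    by (simp_all add: R3H_A2 R3H_uminus eigval_A2 eigval_uminus)
  then show ?thesis
    unfolding orbit_sum_def
    by (intro laplace_eigen_eq_sum laplace_eigen_eq_cmult laplace_eigen_eq_add)
qed

text \<open>Negating the point swaps the two waves of each pair.\<close>

lemma orbit_sum_uminus:
  assumes "\<epsilon> * \<epsilon> = 1"
  shows "orbit_sum c \<epsilon> k (- t) = \<epsilon> * orbit_sum c \<epsilon> k t"
proof -
  have "\<phi> (- \<sigma> k) t + \<epsilon> * \<phi> (\<sigma> k) t = \<epsilon> * (\<phi> (\<sigma> k) t + \<epsilon> * \<phi> (- \<sigma> k) t)" for \<sigma>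
    using assms by (simp add: distrib_left flip: mult.assoc)
  then show ?thesis
    by (simp add: orbit_sum_def \<phi>_uminus sum_distrib_left mult.left_commute)
qed

text \<open>The reflection moves to the frequencies, and reindexing by the bijection
  \<open>\<sigma> \<mapsto> s \<circ> \<sigma>\<close> restores the sum; \<open>\<delta>\<close> is
  1 for the trivial and -1 for the sign character.\<close>

lemma orbit_sum_reflection:
  assumes s: "s \<in> {\<sigma>2, \<sigma>3}" and c: "\<And>\<sigma>. \<sigma> \<in> A2 \<Longrightarrow> c \<sigma> = \<delta> * c (s \<circ> \<sigma>)"
  shows "orbit_sum c \<epsilon> k (s t) = \<delta> * orbit_sum c \<epsilon> k t"
proof -
  define g where "g \<sigma> = c \<sigma> * (\<phi> (\<sigma> k) t + \<epsilon> * \<phi> (- \<sigma> k) t)" for \<sigma>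
  have "orbit_sum c \<epsilon> k (s t) = (\<Sum>\<sigma>\<in>A2. \<delta> * g (s \<circ> \<sigma>))"
    unfolding orbit_sum_def
  proof (rule sum.cong[OF refl])
    fix \<sigma> assume "\<sigma> \<in> A2"
    then show "c \<sigma> * (\<phi> (\<sigma> k) (s t) + \<epsilon> * \<phi> (- \<sigma> k) (s t)) = \<delta> * g (s \<circ> \<sigma>)"
      using s by (subst c) (auto simp: g_def \<phi>_\<sigma> \<sigma>_uminus)
  qed
  also have "\<dots> = \<delta> * (\<Sum>\<sigma>\<in>A2. g \<sigma>)"
    by (simp add: sum.reindex_bij_betw[OF bij_betw_reflection[OF s]] flip: sum_distrib_left)
  finally show ?thesis
    by (simp add: g_def orbit_sum_def)
qed

lemma orbit_sum_period:
  assumes "k \<in> H_dagger"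
  shows "orbit_sum c \<epsilon> k (t + vector [1, 1, - 2]) = orbit_sum c \<epsilon> k t"
  unfolding orbit_sum_def
  by (intro sum.cong) (simp_all add: \<phi>_period H_dagger_A2 H_dagger_uminus assms)

section \<open>Parities and period of the four functions\<close>

lemma trig_uminus:
  "CC k (- t) = CC k t" "SC k (- t) = - SC k t" "CS k (- t) = - CS k t" "SS k (- t) = SS k t"
  by (simp_all add: trig_eq_orbit_sum orbit_sum_uminus)

lemma trig_reflection:
  assumes "s \<in> {\<sigma>2, \<sigma>3}"
  shows "CC k (s t) = CC k t" "SC k (s t) = SC k t" "CS k (s t) = - CS k t" "SS k (s t) = - SS k t"
  using orbit_sum_reflection[OF assms, where \<delta> = 1] orbit_sum_reflection[OF assms, where \<delta> = "- 1"]
  by (simp_all add: trig_eq_orbit_sum sign_A2_reflection[OF assms])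

text \<open>Facts 1-4 concern \<open>\<sigma>2\<close> and 5-8 \<open>\<sigma>3\<close>, each in the
  order \<open>CC\<close>, \<open>SC\<close>, \<open>CS\<close>, \<open>SS\<close>.\<close>

lemmas trig_\<sigma> = trig_reflection[of \<sigma>2, simplified] trig_reflection[of \<sigma>3, simplified]

lemma trig_period:
  assumes "k \<in> H_dagger"
  shows "CC k (t + vector [1, 1, - 2]) = CC k t" "SC k (t + vector [1, 1, - 2]) = SC k t"
    "CS k (t + vector [1, 1, - 2]) = CS k t" "SS k (t + vector [1, 1, - 2]) = SS k t"
  by (simp_all only: trig_eq_orbit_sum orbit_sum_period[OF assms])

subsection \<open>Boundary conditions by reflection\<close>

lemma has_vector_derivative_zero_even:
  fixes f :: "'a::real_normed_vector \<Rightarrow> 'b::real_normed_vector"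
  assumes "f differentiable (at x)" and even: "\<And>s. f (x + s *\<^sub>R n) = f (x - s *\<^sub>R n)"
  shows "((\<lambda>s. f (x + s *\<^sub>R n)) has_vector_derivative 0) (at 0)"
proof -
  obtain f' where f': "(f has_derivative f') (at x)"
    using assms(1) by (auto simp: differentiable_def)
  have lin: "linear f'"
    using f' by (rule has_derivative_linear)
  note * = has_vector_derivative_along_line[OF f']
  \<comment> \<open>The line is traversed in direction \<open>- n\<close>; evenness makes this the
    same function of \<open>s\<close>, so its derivative equals its own negative.\<close>
  have "((\<lambda>s. f (x + s *\<^sub>R n)) has_vector_derivative - f' n) (at 0)"
    using *[of "- n"] by (simp add: even linear_neg[OF lin])
  then have "f' n = - f' n"
    using *[of n] by (rule vector_derivative_unique_at[rotated])
  then have "f' n + f' n = 0"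
    by (metis add.right_inverse)
  then have "f' n = 0"
    by (simp flip: scaleR_2)
  then show ?thesis
    using *[of n] by simp
qed

lemma normal_deriv_zero_onI:
  assumes "laplace_eigen_eq u \<mu>"
    and "\<And>n x s. exterior_normal (cartesian ref_triangle) (cartesian B) n \<Longrightarrow> x \<in> cartesian B \<Longrightarrow>
      u (hom_coords (x + s *\<^sub>R n)) = u (hom_coords (x - s *\<^sub>R n))"
  shows "normal_deriv_zero_on u B"
  unfolding normal_deriv_zero_on_def
proof (intro allI impI ballI has_vector_derivative_zero_even)
  show "(u \<circ> hom_coords) differentiable (at x)" for x
    using assms(1) by (simp add: laplace_eigen_eq_def twice_differentiable_def)
qed (use assms(2) in simp)

text \<open>In coordinates the map is \<open>t \<mapsto> (1 - t2, 1 - t1, - 2 - t3)\<close>, the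
  mirror image in the line \<open>t3 = - 1\<close>.\<close>

lemma hom_coords_reflection_B1:
  assumes "exterior_normal (cartesian ref_triangle) (cartesian B1) n" and "x \<in> cartesian B1"
  shows "hom_coords (x + s *\<^sub>R n) = \<sigma>2 (hom_coords (x - s *\<^sub>R n)) + vector [1, 1, - 2]"
  using assms unfolding exterior_normal_B1 cartesian_B1_iff
  by (simp add: hom_coords_def \<sigma>2_def vec_eq_iff forall_3 field_simps)

lemma hom_coords_reflection_B2:
  assumes "exterior_normal (cartesian ref_triangle) (cartesian B2) n" and "x \<in> cartesian B2"
  shows "hom_coords (x + s *\<^sub>R n) = \<sigma>3 (hom_coords (x - s *\<^sub>R n))"
  using assms unfolding exterior_normal_B2 cartesian_B2_iff
  by (simp add: hom_coords_def \<sigma>3_def vec_eq_iff forall_3 field_simps)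

lemma hom_coords_reflection_B3:
  assumes "exterior_normal (cartesian ref_triangle) (cartesian B3) n" and "x \<in> cartesian B3"
  shows "hom_coords (x + s *\<^sub>R n) = - \<sigma>2 (hom_coords (x - s *\<^sub>R n))"
  using assms unfolding exterior_normal_B3 cartesian_B3_iff
  by (simp add: hom_coords_def \<sigma>2_def vec_eq_iff forall_3 field_simps)

text \<open>Points of a segment lie on its mirror line, so oddness under the reflection becomes
  \<open>u t = - u t\<close> there.\<close>

lemma fixed_B1: "\<sigma>2 t + vector [1, 1, - 2] = t" if "t \<in> B1"
  using that by (simp add: B1_def ref_triangle_def R3H_def \<sigma>2_def vec_eq_iff forall_3)

lemma fixed_B2: "\<sigma>3 t = t" if "t \<in> B2"
  using that by (simp add: B2_def ref_triangle_def R3H_def \<sigma>3_def vec_eq_iff forall_3)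

lemma fixed_B3: "- \<sigma>2 t = t" if "t \<in> B3"
  using that by (simp add: B3_def ref_triangle_def R3H_def \<sigma>2_def vec_eq_iff forall_3)

lemma zero_onI:
  assumes "\<And>t. t \<in> B \<Longrightarrow> u t = - u t"
  shows "zero_on u B"
  using assms by (simp add: zero_on_def)

theorem theorem3p5:
  fixes k :: "real ^ 3"
  assumes "k \<in> H_dagger"
  shows "(\<forall>u\<in>{CC k, SC k, CS k, SS k}.
            laplace_eigen_eq u (- eigval k) \<and>
            ((\<exists>t\<in>R3H. u t \<noteq> 0) \<longrightarrow> laplace_eigenfunction u (- eigval k))) \<and>
         (normal_deriv_zero_on (CC k) B1 \<and> normal_deriv_zero_on (CC k) B2 \<and>
          normal_deriv_zero_on (CC k) B3) \<and>
         (normal_deriv_zero_on (SC k) B1 \<and> normal_deriv_zero_on (SC k) B2 \<and>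
          zero_on (SC k) B3) \<and>
         (normal_deriv_zero_on (CS k) B3 \<and> zero_on (CS k) (B1 \<union> B2)) \<and>
         zero_on (SS k) (B1 \<union> B2 \<union> B3)"
proof -
  have "k \<in> R3H"
    using assms by (simp add: H_dagger_def)
  note orbit = laplace_eigen_eq_orbit_sum[OF this]
  have eigen: "laplace_eigen_eq (CC k) (- eigval k)" "laplace_eigen_eq (SC k) (- eigval k)"
    "laplace_eigen_eq (CS k) (- eigval k)" "laplace_eigen_eq (SS k) (- eigval k)"
    unfolding trig_eq_orbit_sum by (rule orbit)+
  note trig = trig_\<sigma> trig_uminus trig_period[OF assms]
  have CC: "normal_deriv_zero_on (CC k) B1" "normal_deriv_zero_on (CC k) B2"
    "normal_deriv_zero_on (CC k) B3"
    by (rule normal_deriv_zero_onI[OF eigen(1)], simp add: trig hom_coords_reflection_B1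
      hom_coords_reflection_B2 hom_coords_reflection_B3)+
  have SC: "normal_deriv_zero_on (SC k) B1" "normal_deriv_zero_on (SC k) B2"
    by (rule normal_deriv_zero_onI[OF eigen(2)], simp add: trig hom_coords_reflection_B1
      hom_coords_reflection_B2)+
  \<comment> \<open>\<open>CS\<close> changes sign under \<open>\<sigma>2\<close> and under
    negation; the two signs cancel in \<open>- \<sigma>2\<close>.\<close>
  have CS: "normal_deriv_zero_on (CS k) B3"
    by (rule normal_deriv_zero_onI[OF eigen(3)], simp add: trig hom_coords_reflection_B3)
  have odd_B1: "CS k t = - CS k t" "SS k t = - SS k t" if "t \<in> B1" for t
    using trig_\<sigma>(3,4)[of k t] trig_period(3,4)[OF assms, of "\<sigma>2 t"] fixed_B1[OF that] by simp_all
  have odd_B2: "CS k t = - CS k t" "SS k t = - SS k t" if "t \<in> B2" for t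
    using trig_\<sigma>(7,8)[of k t] fixed_B2[OF that] by simp_all
  \<comment> \<open>In \<open>- \<sigma>2\<close> the sign comes from the negation for
    \<open>SC\<close> and from \<open>\<sigma>2\<close> for \<open>SS\<close>.\<close>
  have odd_B3: "SC k t = - SC k t" "SS k t = - SS k t" if "t \<in> B3" for t
    using trig_\<sigma>(2,4)[of k t] trig_uminus(2,4)[of k "\<sigma>2 t"] fixed_B3[OF that] by simp_all
  have "zero_on (SC k) B3" "zero_on (CS k) (B1 \<union> B2)" "zero_on (SS k) (B1 \<union> B2 \<union> B3)"
    using odd_B1 odd_B2 odd_B3 by (blast intro: zero_onI)+
  with eigen CC SC CS show ?thesis
    by (auto simp: laplace_eigenfunction_def)
qed

end
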